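(* Let $p,q\in\mathbb C\setminus\{0\}$, $M,N,n\in\mathbb N_0$ with $n\le N\le M$, and $t\in\mathbb C$. Then $$\sum_{x=0}^M\binom{M}{x}q^x(1-q)^{M-x}\left[e^{t}\,{}_1F_1\!\left(\begin{matrix}-x\\ -N\end{matrix};-\frac{t}{p}\right)\right]_N K_n(x;q,M)=\left(\frac{t(q-1)}{p}\right)^n\frac{1}{(-N)_n}\left[e^t\,{}_1F_1\!\left(\begin{matrix}n-M\\ n-N\end{matrix};\frac{-tq}{p}\right)\right]_{N-n}.$$
   Context: $\mathbb N_0=\{0,1,2,\dots\}$. Pochhammer symbol: $(a)_n=a(a+1)\cdots(a+n-1)$, $(a)_0=1$. ${}_1F_1\!\left(\begin{matrix}a\\ b\end{matrix};z\right)=\sum_{k\ge0}\frac{(a)_k}{(b)_k}\frac{z^k}{k!}$. Truncated Maclaurin expansion in $t$: $[f(t)]_N=\sum_{k=0}^N\frac{f^{(k)}(0)}{k!}t^k$, i.e. the partial sum through degree $N$ of the power series of $f$ in $t$. When the hypergeometric series inside $[\cdot]_L$ has lower parameter $-L$, only its terms of index $\le L$ (which are well defined) contribute, and the bracket is computed from these terms only. Krawtchouk polynomials, for $0\le n\le M$: $K_n(x;q,M)=\sum_{k=0}^n\frac{(-n)_k(-x)_k}{(-M)_k\,k!}\,q^{-k}$ (the ${}_2F_1(-n,-x;-M;1/q)$ understood as the sum up to index $n$). Convention: $0^0=1$. *)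

theory Defs
  imports "HOL-Analysis.Analysis"
begin

text \<open>If \<open>b = - L\<close> for a natural number \<open>L\<close>, then \<open>pochhammer b k = 0\<close> exactly for
  \<open>k > L\<close>. Because \<open>x / 0 = 0\<close>, the series below then consists of its well-defined terms of
  index at most \<open>L\<close>; see \<open>hyp1F1_neg_nat\<close>.\<close>

definition hyp1F1 :: "complex \<Rightarrow> complex \<Rightarrow> complex \<Rightarrow> complex" where
  "hyp1F1 a b z = (\<Sum>k. pochhammer a k / pochhammer b k * (z ^ k / fact k))"

lemma hyp1F1_neg_nat:
  "hyp1F1 a (- of_nat L) z =
     (\<Sum>k\<le>L. pochhammer a k / pochhammer (- of_nat L) k * (z ^ k / fact k))"
  unfolding hyp1F1_def
  by (rule suminf_finite) (auto simp: pochhammer_of_nat_eq_0_iff)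

definition maclaurin_trunc :: "nat \<Rightarrow> (complex \<Rightarrow> complex) \<Rightarrow> complex \<Rightarrow> complex" where
  "maclaurin_trunc N f t = (\<Sum>k\<le>N. (deriv ^^ k) f 0 / fact k * t ^ k)"

text \<open>Meaningful for \<open>n \<le> M\<close>, where no denominator \<open>pochhammer (- M) k\<close> vanishes.\<close>

definition krawtchouk :: "nat \<Rightarrow> complex \<Rightarrow> complex \<Rightarrow> nat \<Rightarrow> complex" where
  "krawtchouk n x q M =
     (\<Sum>k\<le>n. pochhammer (- of_nat n) k * pochhammer (- x) k /
        (pochhammer (- of_nat M) k * fact k) * (1 / q) ^ k)"

end

theory Submission imports Defs begin

text \<open>Both sides are linear combinations of the same quantities. If \<open>E\<^sub>m(t)\<close> is the partial sum
  of \<open>exp t\<close> through degree \<open>m\<close>, then multiplying by \<open>exp t\<close> and truncating at degree \<open>L\<close> turns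
  a polynomial \<open>\<Sum>k\<le>L. c\<^sub>k t\<^sup>k\<close> into \<open>\<Sum>k\<le>L. c\<^sub>k t\<^sup>k E\<^bsub>L-k\<^esub>(t)\<close>
  (\<open>maclaurin_trunc_exp_mult_polynomial\<close>). On the left, \<open>x\<close> enters the coefficient of
  \<open>t\<^sup>k E\<^bsub>N-k\<^esub>(t)\<close> only through the factor \<open>(-x)\<^sub>k / k! = (-1)\<^sup>k (x choose k)\<close>. The identity
  therefore reduces to one moment of the Krawtchouk polynomial under the binomial weight,
  \<open>krawtchouk_signed_choose_mean\<close>:
  the mean of \<open>(-1)\<^sup>k (x choose k) K\<^sub>n(x)\<close> is \<open>0\<close> for \<open>k < n\<close>, which is orthogonality to lower
  degree, and \<open>(1-q)\<^sup>n (-q)\<^bsup>k-n\<^esup> (M-n choose k-n)\<close> for \<open>k \<ge> n\<close>.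
  Putting \<open>k = n + j\<close> gives the coefficients on the right.

  The moment is found without expanding a product of two polynomials in \<open>x\<close>. The \<open>l\<close>-th term of
  \<open>K\<^sub>n\<close> is, up to a constant, \<open>(x choose l) / ((M choose l) q\<^sup>l)\<close>, and such a factor turns the
  binomial weight with \<open>M\<close> trials into the one with \<open>M - l\<close> trials, shifted by \<open>l\<close>
  (\<open>binomial_mean_mult_choose\<close>): it conditions \<open>l\<close> of the trials to succeed. The sum over \<open>l\<close>
  thus compares, with alternating signs, trials that are forced to succeed with trials that are
  free. Each comparison yields a factor \<open>1 - q\<close> and one finite difference
  (\<open>alternating_binomial_mean\<close>), and finite differences merely lower \<open>k\<close> in
  \<open>(-1)\<^sup>k (x choose k)\<close>.\<close>

section \<open>Binomial means\<close>

text \<open>The parameter \<open>q\<close> is an arbitrary ring element, so this is the expectation of a binomial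
  random variable only in a formal sense. The language of trials in the comments below stands for
  identities between the weights.\<close>

definition binomial_mean :: "'a::comm_ring_1 \<Rightarrow> nat \<Rightarrow> (nat \<Rightarrow> 'a) \<Rightarrow> 'a" where
  "binomial_mean q m f = (\<Sum>x\<le>m. of_nat (m choose x) * q ^ x * (1 - q) ^ (m - x) * f x)"

lemma binomial_mean_one: "binomial_mean q m (\<lambda>x. 1) = 1"
  using binomial_ring[of q "1 - q" m] by (simp add: binomial_mean_def)

lemma binomial_mean_diff:
  "binomial_mean q m (\<lambda>x. f x - g x) = binomial_mean q m f - binomial_mean q m g"
  by (simp add: binomial_mean_def right_diff_distrib sum_subtractf)

lemma binomial_mean_cmult: "binomial_mean q m (\<lambda>x. c * f x) = c * binomial_mean q m f"
  by (simp add: binomial_mean_def sum_distrib_left mult_ac)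

lemma binomial_mean_sum:
  "binomial_mean q m (\<lambda>x. \<Sum>i\<in>I. f i x) = (\<Sum>i\<in>I. binomial_mean q m (f i))"
  unfolding binomial_mean_def sum_distrib_left by (rule sum.swap)

text \<open>Condition on the outcome of one trial: it fails with weight \<open>1 - q\<close> and succeeds, raising the
  number of successes by one, with weight \<open>q\<close>.\<close>

lemma binomial_mean_Suc:
  "binomial_mean q (Suc m) f =
     (1 - q) * binomial_mean q m f + q * binomial_mean q m (\<lambda>x. f (Suc x))"
proof -
  let ?w = "\<lambda>x. of_nat (m choose x) * q ^ x * (1 - q) ^ (Suc m - x) * f x"
  have tail: "of_nat (Suc m choose Suc x) * q ^ Suc x * (1 - q) ^ (Suc m - Suc x) * f (Suc x)
      = ?w (Suc x) + q * (of_nat (m choose x) * q ^ x * (1 - q) ^ (m - x) * f (Suc x))" for x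
    by (simp add: algebra_simps)
  have "binomial_mean q (Suc m) f
      = ?w 0 + (\<Sum>x\<le>m. ?w (Suc x)) + q * binomial_mean q m (\<lambda>x. f (Suc x))"
    unfolding binomial_mean_def
    by (subst sum.atMost_Suc_shift, subst sum.cong[OF refl tail])
       (simp add: sum.distrib sum_distrib_left)
  \<comment> \<open>The additional term, at \<open>Suc m\<close>, contains \<open>m choose Suc m = 0\<close>.\<close>
  also have "?w 0 + (\<Sum>x\<le>m. ?w (Suc x)) = (\<Sum>x\<le>Suc m. ?w x)"
    by (rule sum.atMost_Suc_shift[symmetric])
  also have "\<dots> = (1 - q) * binomial_mean q m f"
    by (simp add: binomial_mean_def sum_distrib_left Suc_diff_le binomial_eq_0 mult_ac)
  finally show ?thesis .
qed

text \<open>The factor \<open>x choose l\<close> selects \<open>l\<close> of the \<open>x\<close> successes. Choosing these \<open>l\<close> trials first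
  leaves \<open>m - l\<close> free trials; this is
  \<open>(m choose x) (x choose l) = (m choose l) (m - l choose x - l)\<close>.\<close>

lemma binomial_mean_mult_choose:
  assumes "l \<le> m"
  shows "binomial_mean q m (\<lambda>x. of_nat (x choose l) * f x)
       = of_nat (m choose l) * q ^ l * binomial_mean q (m - l) (\<lambda>y. f (y + l))"
proof -
  have "binomial_mean q m (\<lambda>x. of_nat (x choose l) * f x)
      = (\<Sum>x\<in>{l..m}. of_nat (m choose x) * q ^ x * (1 - q) ^ (m - x) * (of_nat (x choose l) * f x))"
    unfolding binomial_mean_def by (rule sum.mono_neutral_right) (auto simp: binomial_eq_0)
  also have "\<dots> = (\<Sum>y\<le>m - l. of_nat (m choose l) * q ^ l *
      (of_nat ((m - l) choose y) * q ^ y * (1 - q) ^ (m - l - y) * f (y + l)))"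
  proof (rule sum.reindex_bij_witness[of _ "\<lambda>y. y + l" "\<lambda>x. x - l"])
    fix x assume x: "x \<in> {l..m}"
    have choose: "(of_nat (m choose x) :: 'a) * of_nat (x choose l)
        = of_nat (m choose l) * of_nat ((m - l) choose (x - l))"
      using x choose_mult[of l x m] by (simp flip: of_nat_mult)
    have idx: "q ^ x = q ^ l * q ^ (x - l)" "m - l - (x - l) = m - x" "x - l + l = x"
      using x by (auto simp flip: power_add)
    have "of_nat (m choose x) * q ^ x * (1 - q) ^ (m - x) * (of_nat (x choose l) * f x)
        = (of_nat (m choose x) * of_nat (x choose l)) * (q ^ x * (1 - q) ^ (m - x) * f x)"
      by (simp only: mult_ac)
    also have "\<dots> = of_nat (m choose l) * q ^ l * (of_nat ((m - l) choose (x - l)) * q ^ (x - l) *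
          (1 - q) ^ (m - l - (x - l)) * f (x - l + l))"
      unfolding choose idx by (simp only: mult_ac)
    finally show "of_nat (m choose l) * q ^ l * (of_nat ((m - l) choose (x - l)) * q ^ (x - l) *
          (1 - q) ^ (m - l - (x - l)) * f (x - l + l))
        = of_nat (m choose x) * q ^ x * (1 - q) ^ (m - x) * (of_nat (x choose l) * f x)"
      by (rule sym)
  qed (use assms in auto)
  finally show ?thesis by (simp add: binomial_mean_def sum_distrib_left)
qed

lemma binomial_mean_choose:
  "binomial_mean q m (\<lambda>x. of_nat (x choose k)) = of_nat (m choose k) * q ^ k"
proof (cases "k \<le> m")
  case True
  then show ?thesis
    using binomial_mean_mult_choose[of k m q "\<lambda>x. 1"] by (simp add: binomial_mean_one)
qed (simp add: binomial_mean_def binomial_eq_0)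

section \<open>Alternating sums of binomial means\<close>

text \<open>The negative of the forward difference. This sign spares a factor \<open>(-1) ^ n\<close> in the
  \<open>n\<close>-th iterate.\<close>

definition decrement :: "(nat \<Rightarrow> 'a::comm_ring_1) \<Rightarrow> nat \<Rightarrow> 'a" where
  "decrement f x = f x - f (Suc x)"

text \<open>If one trial is made to succeed instead of being left free, the mean changes only when the free
  trial would have failed. By \<open>binomial_mean_Suc\<close>, the difference of the two means is
  \<open>1 - q\<close> times the mean of \<open>decrement f\<close> over the remaining trials. Pascal's rule for
  \<open>n choose l\<close> pairs the terms so that this can be applied \<open>n\<close> times.\<close>

lemma alternating_binomial_mean:
  assumes "n \<le> m"
  shows "(\<Sum>l\<le>n. (-1) ^ l * of_nat (n choose l) * binomial_mean q (m - l) (\<lambda>y. f (y + l)))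
       = (1 - q) ^ n * binomial_mean q (m - n) ((decrement ^^ n) f)"
  using assms
proof (induction n arbitrary: m f)
  case 0
  then show ?case by simp
next
  case (Suc n)
  let ?B = "\<lambda>i l. binomial_mean q i (\<lambda>y. f (y + l))"
  let ?a = "\<lambda>l. (-1) ^ l * of_nat (n choose l) :: 'a"
  have pascal: "(-1) ^ Suc l * of_nat (Suc n choose Suc l) * ?B (m - Suc l) (Suc l)
      = ?a (Suc l) * ?B (m - Suc l) (Suc l) - ?a l * ?B (m - Suc l) (Suc l)" for l
    by (simp add: algebra_simps)
  have "(\<Sum>l\<le>Suc n. (-1) ^ l * of_nat (Suc n choose l) * ?B (m - l) l)
      = ?a 0 * ?B m 0 + (\<Sum>l\<le>n. ?a (Suc l) * ?B (m - Suc l) (Suc l))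
        - (\<Sum>l\<le>n. ?a l * ?B (m - Suc l) (Suc l))"
    by (subst sum.atMost_Suc_shift, subst sum.cong[OF refl pascal]) (simp add: sum_subtractf)
  also have "?a 0 * ?B m 0 + (\<Sum>l\<le>n. ?a (Suc l) * ?B (m - Suc l) (Suc l))
      = (\<Sum>l\<le>Suc n. ?a l * ?B (m - l) l)"
    by (subst sum.atMost_Suc_shift) simp
  also have "\<dots> = (\<Sum>l\<le>n. ?a l * ?B (m - l) l)"
    by (simp add: binomial_eq_0)
  also have "\<dots> - (\<Sum>l\<le>n. ?a l * ?B (m - Suc l) (Suc l))
      = (\<Sum>l\<le>n. ?a l * (?B (m - l) l - ?B (m - Suc l) (Suc l)))"
    by (simp add: sum_subtractf right_diff_distrib)
  also have "\<dots> = (\<Sum>l\<le>n. (1 - q) *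
      (?a l * binomial_mean q (m - 1 - l) (\<lambda>y. decrement f (y + l))))"
  proof (rule sum.cong[OF refl])
    fix l assume "l \<in> {..n}"
    then have ml: "m - l = Suc (m - Suc l)" using Suc.prems by simp
    have "?B (m - l) l - ?B (m - Suc l) (Suc l)
        = (1 - q) * (?B (m - Suc l) l - ?B (m - Suc l) (Suc l))"
      unfolding ml by (simp add: binomial_mean_Suc algebra_simps)
    also have "\<dots> = (1 - q) * binomial_mean q (m - 1 - l) (\<lambda>y. decrement f (y + l))"
      by (simp add: decrement_def flip: binomial_mean_diff)
    finally show "?a l * (?B (m - l) l - ?B (m - Suc l) (Suc l))
        = (1 - q) * (?a l * binomial_mean q (m - 1 - l) (\<lambda>y. decrement f (y + l)))"
      by (simp add: mult_ac)
  qed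
  also have "\<dots> = (1 - q) * ((1 - q) ^ n * binomial_mean q (m - 1 - n) ((decrement ^^ n) (decrement f)))"
    using Suc.IH[of "m - 1" "decrement f"] Suc.prems
    by (simp flip: sum_distrib_left)
  finally show ?case
    by (simp add: funpow_swap1 mult_ac)
qed

text \<open>This is \<open>pochhammer (- x) k / fact k\<close>, in a form that makes sense in every commutative ring. In
  this normalisation \<open>decrement\<close> lowers \<open>k\<close> without producing a constant.\<close>

definition signed_choose :: "nat \<Rightarrow> nat \<Rightarrow> 'a::comm_ring_1" where
  "signed_choose k x = (-1) ^ k * of_nat (x choose k)"

lemma binomial_mean_signed_choose:
  "binomial_mean q m (signed_choose k) = signed_choose k m * q ^ k"
  using binomial_mean_cmult[of q m "(-1) ^ k" "\<lambda>x. of_nat (x choose k)"]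
  by (simp add: signed_choose_def[abs_def] binomial_mean_choose mult_ac)

lemma decrement_signed_choose_Suc: "decrement (signed_choose (Suc k)) = signed_choose k"
  by (rule ext) (simp add: decrement_def signed_choose_def algebra_simps)

lemma decrement_pow_signed_choose:
  "n \<le> k \<Longrightarrow> (decrement ^^ n) (signed_choose k) = signed_choose (k - n)"
proof (induction n)
  case (Suc n)
  then show ?case
    by (simp add: Suc_diff_Suc[symmetric] decrement_signed_choose_Suc)
qed simp

lemma decrement_pow_signed_choose_eq_0:
  assumes "k < n"
  shows "(decrement ^^ n) (signed_choose k) = (\<lambda>x. 0)"
proof -
  have zero: "(decrement ^^ i) (\<lambda>x. 0) = (\<lambda>x. 0 :: 'a)" for i
    by (induction i) (auto simp: decrement_def)
  have "decrement (signed_choose 0) = (\<lambda>x. 0 :: 'a)"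
    by (rule ext) (simp add: decrement_def signed_choose_def)
  then have "(decrement ^^ Suc k) (signed_choose k) = (\<lambda>x. 0 :: 'a)"
    by (simp add: decrement_pow_signed_choose)
  moreover have "n = (n - Suc k) + Suc k" using assms by simp
  ultimately show ?thesis
    by (metis funpow_add o_apply zero)
qed

section \<open>Moments of Krawtchouk polynomials\<close>

lemma pochhammer_minus_of_nat:
  "pochhammer (- of_nat x :: complex) k = signed_choose k x * fact k"
  unfolding signed_choose_def binomial_gbinomial gbinomial_pochhammer by simp

lemma krawtchouk_eq_choose_sum:
  assumes "n \<le> M"
  shows "krawtchouk n (of_nat x) q M =
    (\<Sum>l\<le>n. (-1) ^ l * of_nat (n choose l) / (of_nat (M choose l) * q ^ l) * of_nat (x choose l))"
  unfolding krawtchouk_def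
  by (rule sum.cong[OF refl])
     (use assms in \<open>simp add: pochhammer_minus_of_nat signed_choose_def minus_one_power_iff field_simps\<close>)

text \<open>The constants \<open>(M choose l) * q ^ l\<close> from \<open>binomial_mean_mult_choose\<close> cancel the denominators
  of the Krawtchouk polynomial exactly. What remains is an alternating sum of binomial means, and
  after \<open>n\<close> differences the mean of a binomial coefficient. For \<open>k < n\<close> the \<open>n\<close>-th difference
  vanishes because \<open>x choose k\<close> has degree \<open>k\<close> in \<open>x\<close>.\<close>

lemma krawtchouk_signed_choose_mean:
  assumes "n \<le> M" and q: "q \<noteq> 0"
  shows "binomial_mean q M (\<lambda>x. signed_choose k x * krawtchouk n (of_nat x) q M) =
    (if k < n then 0 else (1 - q) ^ n * signed_choose (k - n) (M - n) * q ^ (k - n))"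
proof -
  let ?c = "\<lambda>l. (-1) ^ l * of_nat (n choose l) / (of_nat (M choose l) * q ^ l)"
  have "(\<lambda>x. signed_choose k x * krawtchouk n (of_nat x) q M)
      = (\<lambda>x. \<Sum>l\<le>n. ?c l * (of_nat (x choose l) * signed_choose k x))"
    by (rule ext) (simp add: krawtchouk_eq_choose_sum[OF assms(1)] sum_distrib_left mult_ac)
  then have "binomial_mean q M (\<lambda>x. signed_choose k x * krawtchouk n (of_nat x) q M)
      = (\<Sum>l\<le>n. ?c l * binomial_mean q M (\<lambda>x. of_nat (x choose l) * signed_choose k x))"
    by (simp only: binomial_mean_sum binomial_mean_cmult)
  also have "\<dots> = (\<Sum>l\<le>n. (-1) ^ l * of_nat (n choose l) *
      binomial_mean q (M - l) (\<lambda>y. signed_choose k (y + l)))"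
    by (rule sum.cong[OF refl])
       (use assms in \<open>simp add: binomial_mean_mult_choose\<close>)
  also have "\<dots> = (1 - q) ^ n * binomial_mean q (M - n) ((decrement ^^ n) (signed_choose k))"
    by (rule alternating_binomial_mean) fact
  also have "\<dots> = (if k < n then 0 else (1 - q) ^ n * signed_choose (k - n) (M - n) * q ^ (k - n))"
    by (simp add: decrement_pow_signed_choose_eq_0 decrement_pow_signed_choose
        binomial_mean_signed_choose binomial_mean_def[of _ _ "\<lambda>x. 0"])
  finally show ?thesis .
qed

section \<open>Truncated products with the exponential function\<close>

definition exp_partial_sum :: "nat \<Rightarrow> complex \<Rightarrow> complex" where
  "exp_partial_sum m t = (\<Sum>j\<le>m. t ^ j / fact j)"

text \<open>Truncating \<open>t ^ k * exp t\<close> at degree \<open>N\<close> truncates its exponential factor at degree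
  \<open>N - k\<close>. The derivatives at \<open>0\<close> are read off as coefficients of a product of formal power
  series.\<close>

lemma maclaurin_trunc_exp_mult_polynomial:
  "maclaurin_trunc N (\<lambda>s. exp s * (\<Sum>k\<le>N. c k * s ^ k)) t =
     (\<Sum>k\<le>N. c k * t ^ k * exp_partial_sum (N - k) t)"
proof -
  define P where "P = (\<Sum>k\<le>N. fps_const (c k) * fps_X ^ k)"
  have "(\<lambda>s. exp s * (\<Sum>k\<le>N. c k * s ^ k)) has_fps_expansion fps_exp 1 * P"
    unfolding P_def by (intro fps_expansion_intros)
  note coeff = fps_nth_fps_expansion[OF this, symmetric]
  have P: "fps_nth P k = c k" if "k \<le> N" for k
    using that by (simp add: P_def fps_sum_nth fps_X_power_nth if_distrib[of "(*) _"] cong: if_cong)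
  have "maclaurin_trunc N (\<lambda>s. exp s * (\<Sum>k\<le>N. c k * s ^ k)) t
      = (\<Sum>i\<le>N. fps_nth (P * fps_exp 1) i * t ^ i)"
    unfolding maclaurin_trunc_def coeff by (simp add: mult.commute)
  also have "\<dots> = (\<Sum>i\<le>N. \<Sum>k\<le>i. c k * t ^ k * (t ^ (i - k) / fact (i - k)))"
  proof (rule sum.cong[OF refl])
    fix i assume i: "i \<in> {..N}"
    have "fps_nth (P * fps_exp 1) i * t ^ i
        = (\<Sum>k\<le>i. fps_nth P k / fact (i - k) * t ^ i)"
      by (simp add: fps_mult_nth sum_distrib_right atLeast0AtMost)
    also have "\<dots> = (\<Sum>k\<le>i. c k * t ^ k * (t ^ (i - k) / fact (i - k)))"
      by (rule sum.cong[OF refl]) (use i in \<open>simp add: P mult_ac flip: power_add\<close>)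
    finally show "fps_nth (P * fps_exp 1) i * t ^ i
        = (\<Sum>k\<le>i. c k * t ^ k * (t ^ (i - k) / fact (i - k)))" .
  qed
  also have "\<dots> = (\<Sum>k\<le>N. \<Sum>j\<le>N - k. c k * t ^ k * (t ^ j / fact j))"
    unfolding sum.Sigma[OF finite_atMost ballI[OF finite_atMost]]
    by (rule sum.reindex_bij_witness[of _ "\<lambda>(k, j). (k + j, k)" "\<lambda>(i, k). (k, i - k)"]) auto
  finally show ?thesis
    by (simp add: exp_partial_sum_def sum_distrib_left)
qed

text \<open>This covers both sides of the final identity: \<open>a = x\<close>, \<open>L = N\<close>, \<open>u = - 1 / p\<close> on the left, and
  \<open>a = M - n\<close>, \<open>L = N - n\<close>, \<open>u = - q / p\<close> on the right.\<close>

lemma maclaurin_trunc_exp_mult_hyp1F1: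
  "maclaurin_trunc L (\<lambda>s. exp s * hyp1F1 (- of_nat a) (- of_nat L) (s * u)) t =
     (\<Sum>k\<le>L. signed_choose k a * (t * u) ^ k / pochhammer (- of_nat L) k * exp_partial_sum (L - k) t)"
proof -
  have "hyp1F1 (- of_nat a) (- of_nat L) (s * u)
      = (\<Sum>k\<le>L. signed_choose k a * u ^ k / pochhammer (- of_nat L) k * s ^ k)" for s
    unfolding hyp1F1_neg_nat pochhammer_minus_of_nat[of a]
    by (simp add: power_mult_distrib mult_ac)
  then show ?thesis
    by (simp only: maclaurin_trunc_exp_mult_polynomial) (simp add: power_mult_distrib mult_ac)
qed

section \<open>The Krawtchouk transform of the truncated product\<close>

theorem corollary26:
  fixes p q t :: complex and M N n :: nat
  assumes "p \<noteq> 0" and "q \<noteq> 0" and "n \<le> N" and "N \<le> M"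
  shows "(\<Sum>x=0..M. of_nat (M choose x) * q ^ x * (1 - q) ^ (M - x) *
            maclaurin_trunc N (\<lambda>s. exp s * hyp1F1 (- of_nat x) (- of_nat N) (- s / p)) t *
            krawtchouk n (of_nat x) q M)
       = (t * (q - 1) / p) ^ n * (1 / pochhammer (- of_nat N) n) *
           maclaurin_trunc (N - n)
             (\<lambda>s. exp s * hyp1F1 (of_nat n - of_nat M) (of_nat n - of_nat N) (- s * q / p)) t"
proof -
  let ?w = "\<lambda>k. (t * (- 1 / p)) ^ k / pochhammer (- of_nat N) k * exp_partial_sum (N - k) t"
  let ?S = "\<lambda>k. binomial_mean q M (\<lambda>x. signed_choose k x * krawtchouk n (of_nat x) q M)"
  have lhs: "maclaurin_trunc N (\<lambda>s. exp s * hyp1F1 (- of_nat x) (- of_nat N) (- s / p)) t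
      = (\<Sum>k\<le>N. ?w k * signed_choose k x)" for x
    using maclaurin_trunc_exp_mult_hyp1F1[of N x "- 1 / p" t] by (simp add: mult_ac)
  have rhs: "maclaurin_trunc (N - n)
        (\<lambda>s. exp s * hyp1F1 (of_nat n - of_nat M) (of_nat n - of_nat N) (- s * q / p)) t
      = (\<Sum>j\<le>N - n. signed_choose j (M - n) * (t * (- q / p)) ^ j / pochhammer (of_nat n - of_nat N) j
          * exp_partial_sum (N - n - j) t)"
    using maclaurin_trunc_exp_mult_hyp1F1[of "N - n" "M - n" "- q / p" t] assms(3,4)
    by (simp add: of_nat_diff)
  have "(\<Sum>x=0..M. of_nat (M choose x) * q ^ x * (1 - q) ^ (M - x) *
            maclaurin_trunc N (\<lambda>s. exp s * hyp1F1 (- of_nat x) (- of_nat N) (- s / p)) t *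
            krawtchouk n (of_nat x) q M)
      = binomial_mean q M (\<lambda>x. \<Sum>k\<le>N. ?w k * (signed_choose k x * krawtchouk n (of_nat x) q M))"
    unfolding lhs binomial_mean_def atLeast0AtMost by (simp add: sum_distrib_left sum_distrib_right mult_ac)
  also have "\<dots> = (\<Sum>k\<le>N. ?w k * ?S k)"
    by (simp only: binomial_mean_sum binomial_mean_cmult)
  \<comment> \<open>Orthogonality removes the terms with \<open>k < n\<close>.\<close>
  also have "\<dots> = (\<Sum>k\<in>{n..N}. ?w k * ?S k)"
    using assms by (intro sum.mono_neutral_right) (auto simp: krawtchouk_signed_choose_mean)
  also have "\<dots> = (\<Sum>j\<le>N - n. (t * (q - 1) / p) ^ n * (1 / pochhammer (- of_nat N) n) *
      (signed_choose j (M - n) * (t * (- q / p)) ^ j / pochhammer (of_nat n - of_nat N) j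
          * exp_partial_sum (N - n - j) t))"
  proof (rule sum.reindex_bij_witness[of _ "\<lambda>j. n + j" "\<lambda>k. k - n"])
    fix k assume k: "k \<in> {n..N}"
    define j where "j = k - n"
    have kj: "k = n + j" using k by (simp add: j_def)
    have sgn: "(t * (- 1 / p)) ^ (n + j) * ((1 - q) ^ n * q ^ j)
        = (t * (q - 1) / p) ^ n * (t * (- q / p)) ^ j"
    proof -
      have "t * (- 1 / p) * (1 - q) = t * (q - 1) / p" "t * (- 1 / p) * q = t * (- q / p)"
        using assms(1) by (simp_all add: field_simps)
      moreover have "(t * (- 1 / p)) ^ (n + j) * ((1 - q) ^ n * q ^ j)
          = (t * (- 1 / p) * (1 - q)) ^ n * (t * (- 1 / p) * q) ^ j"
        by (simp only: power_add power_mult_distrib mult_ac)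
      ultimately show ?thesis by simp
    qed
    have poch: "pochhammer (- of_nat N :: complex) (n + j)
        = pochhammer (- of_nat N) n * pochhammer (of_nat n - of_nat N) j"
      by (simp add: pochhammer_product')
    have "?w k * ?S k = (t * (- 1 / p)) ^ (n + j) * ((1 - q) ^ n * q ^ j) *
        signed_choose j (M - n) / pochhammer (- of_nat N) (n + j) * exp_partial_sum (N - n - j) t"
      using assms by (simp add: kj krawtchouk_signed_choose_mean)
    then show "(t * (q - 1) / p) ^ n * (1 / pochhammer (- of_nat N) n) *
      (signed_choose (k - n) (M - n) * (t * (- q / p)) ^ (k - n) / pochhammer (of_nat n - of_nat N) (k - n)
          * exp_partial_sum (N - n - (k - n)) t) = ?w k * ?S k"
      unfolding sgn poch by (simp add: kj)
  qed (use assms in auto)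
  also have "\<dots> = (t * (q - 1) / p) ^ n * (1 / pochhammer (- of_nat N) n) * maclaurin_trunc (N - n)
             (\<lambda>s. exp s * hyp1F1 (of_nat n - of_nat M) (of_nat n - of_nat N) (- s * q / p)) t"
    unfolding rhs by (rule sum_distrib_left[symmetric])
  finally show ?thesis .
qed

end
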